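(* Suppose $f:\mathbb{R}^n\to\mathbb{R}$ is in $\mathcal{C}^{2+}$ with Lipschitz constant $L_{\nabla^2 f}$. Suppose $D\in\mathbb{R}^{n\times p}$ has full-column rank and let $x^0\in\mathbb{R}^n$. Suppose the $QR$-factorization of $D$ is $D=QR$, where $Q\in\mathbb{R}^{n\times p}$ and $R=[r_1\cdots r_p]\in\mathbb{R}^{p\times p}$. Let $\widehat f(\widehat s)=f(x^0+Q\widehat s)$ for $\widehat s\in\mathbb{R}^p$, and $$\widehat m(\widehat s)=\widehat f(\mathbf 0)+\left(2\nabla_S\widehat f(\mathbf 0;R)-\nabla_S\widehat f(\mathbf 0;2R)\right)^\top\widehat s+\frac12\widehat s^\top\nabla_S^2\widehat f(\mathbf 0;R)\widehat s .$$ Put $\overline{\mathrm{diam}}(R)=\max_{1\le i\le p}\|r_i\|$ and $\widehat R=R/\overline{\mathrm{diam}}(R)$. Then for all $\widehat s\in\mathbb{R}^p$ with $\|\widehat s\|\le\overline{\mathrm{diam}}(R)$, $$\left\|Q^\top\nabla^2 f(x^0+Q\widehat s)Q-\nabla^2\widehat m(\widehat s)\right\|\le L_{\nabla^2 f}\left(4p\|\widehat R^{-\top}\|^2+1\right)\overline{\mathrm{diam}}(R),$$ $$\left\|Q^\top\nabla f(x^0+Q\widehat s)-\nabla\widehat m(\widehat s)\right\|\le 3\sqrt p\,L_{\nabla^2 f}\|\widehat R^{-\top}\|\left(2p\|\widehat R^{-\top}\|^2+1\right)\overline{\mathrm{diam}}(R)^2,$$ $$\left|f(x^0+Q\widehat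 s)-\widehat m(\widehat s)\right|\le\left(\sqrt p\,L_{\nabla^2 f}\|\widehat R^{-\top}\|\left(6p\|\widehat R^{-\top}\|^2+2\sqrt p\,\|\widehat R^{-\top}\|+3\right)+\frac23L_{\nabla^2 f}\right)\overline{\mathrm{diam}}(R)^3.$$
   Context: $\|\cdot\|$ is the Euclidean vector norm and the induced (spectral) matrix norm. $f\in\mathcal{C}^{2+}$ with Lipschitz constant $L_{\nabla^2 f}$ means $f$ is twice continuously differentiable and $\nabla^2 f$ is Lipschitz continuous on $\mathbb{R}^n$ with constant $L_{\nabla^2 f}$. In the $QR$-factorization, $Q$ has orthonormal columns and $R$ is upper triangular (and invertible). $\widehat R^{-\top}=(\widehat R^{-1})^\top$. $A^\dagger$ is the Moore–Penrose pseudoinverse of $A$. For $g:\mathbb{R}^p\to\mathbb{R}$, $y\in\mathbb{R}^p$ and $M=[m_1\cdots m_z]\in\mathbb{R}^{p\times z}$: $\delta_g(y;M)\in\mathbb{R}^z$ is the vector with $i$-th entry $g(y+m_i)-g(y)$; the generalized simplex gradient is $\nabla_S g(y;M)=(M^\top)^\dagger\delta_g(y;M)$; $\delta_{\nabla_S g}(y;M)\in\mathbb{R}^{z\times p}$ is the matrix with $i$-th row $(\nabla_S g(y+m_i;M)-\nabla_S g(y;M))^\top$; the generalized simplex Hessian is $\nabla_S^2 g(y;M)=(M^\top)^\dagger\delta_{\nabla_S g}(y;M)$. *)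

theory Defs
  imports "HOL-Analysis.Analysis"
begin

definition spectral_norm :: "real ^ 'n ^ 'm \<Rightarrow> real" where
  "spectral_norm A = onorm (\<lambda>v. A *v v)"

text \<open>Vector of partial derivatives; meaningful where \<open>f\<close> is differentiable.\<close>

definition grad :: "(real ^ 'n \<Rightarrow> real) \<Rightarrow> real ^ 'n \<Rightarrow> real ^ 'n" where
  "grad f x = (\<chi> i. frechet_derivative f (at x) (axis i 1))"

definition hessian :: "(real ^ 'n \<Rightarrow> real) \<Rightarrow> real ^ 'n \<Rightarrow> real ^ 'n ^ 'n" where
  "hessian f x = jacobian (grad f) (at x)"

text \<open>The Lipschitz bound is spelled out because the library predicate
  \<open>lipschitz_on\<close> would measure matrices in the Frobenius norm, the norm of the
  nested vector type, and not in the spectral norm.\<close>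

definition C2_plus :: "(real ^ 'n \<Rightarrow> real) \<Rightarrow> real \<Rightarrow> bool" where
  "C2_plus f L \<longleftrightarrow>
     (\<forall>x. f differentiable (at x)) \<and>
     (\<forall>x. grad f differentiable (at x)) \<and>
     continuous_on UNIV (hessian f) \<and>
     0 \<le> L \<and>
     (\<forall>x y. spectral_norm (hessian f x - hessian f y) \<le> L * norm (x - y))"

text \<open>An index type of class linorder plays the role of \<open>{1, \<dots>, p}\<close> with its usual order.\<close>

definition upper_triangular ::
    "real ^ ('p::{finite,linorder}) ^ ('p::{finite,linorder}) \<Rightarrow> bool" where
  "upper_triangular R \<longleftrightarrow> (\<forall>i j. j < i \<longrightarrow> R $ i $ j = 0)"

definition orthonormal_columns :: "real ^ 'p ^ 'n \<Rightarrow> bool" where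
  "orthonormal_columns Q \<longleftrightarrow>
     (\<forall>i j. column i Q \<bullet> column j Q = (if i = j then 1 else 0))"

definition is_QR_factorization ::
    "real ^ ('p::{finite,linorder}) ^ 'n \<Rightarrow> real ^ ('p::{finite,linorder}) ^ 'n \<Rightarrow>
      real ^ ('p::{finite,linorder}) ^ ('p::{finite,linorder}) \<Rightarrow> bool" where
  "is_QR_factorization D Q R \<longleftrightarrow>
     orthonormal_columns Q \<and> upper_triangular R \<and> invertible R \<and> D = Q ** R"

text \<open>The four Penrose conditions. Every real matrix has exactly one such \<open>X\<close>;
  uniqueness is shown below.\<close>

definition is_pinv :: "real ^ 'n ^ 'm \<Rightarrow> real ^ 'm ^ 'n \<Rightarrow> bool" where
  "is_pinv A X \<longleftrightarrow>
     A ** X ** A = A \<and> X ** A ** X = X \<and>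
     transpose (A ** X) = A ** X \<and> transpose (X ** A) = X ** A"

definition pinv :: "real ^ 'n ^ 'm \<Rightarrow> real ^ 'm ^ 'n" where
  "pinv A = (THE X. is_pinv A X)"

lemma is_pinv_unique:
  assumes "is_pinv A X" "is_pinv A Y"
  shows "X = Y"
proof -
  have a: "A ** X = A ** Y"
    using assms unfolding is_pinv_def
    by (metis (no_types, lifting) matrix_mul_assoc matrix_transpose_mul)
  have b: "X ** A = Y ** A"
    using assms unfolding is_pinv_def
    by (metis (no_types, lifting) matrix_mul_assoc matrix_transpose_mul)
  show ?thesis
    using assms a b unfolding is_pinv_def by (metis matrix_mul_assoc)
qed

lemma pinv_eqI: "is_pinv A X \<Longrightarrow> pinv A = X"
  unfolding pinv_def using is_pinv_unique by blast

text \<open>The vectors \<open>m\<^sub>i\<close> are the columns of \<open>M\<close>.\<close>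

definition simplex_delta :: "(real ^ 'p \<Rightarrow> real) \<Rightarrow> real ^ 'p \<Rightarrow> real ^ 'z ^ 'p \<Rightarrow> real ^ 'z" where
  "simplex_delta g y M = (\<chi> i. g (y + column i M) - g y)"

definition simplex_gradient :: "(real ^ 'p \<Rightarrow> real) \<Rightarrow> real ^ 'p \<Rightarrow> real ^ 'z ^ 'p \<Rightarrow> real ^ 'p" where
  "simplex_gradient g y M = pinv (transpose M) *v simplex_delta g y M"

definition simplex_gradient_delta ::
    "(real ^ 'p \<Rightarrow> real) \<Rightarrow> real ^ 'p \<Rightarrow> real ^ 'z ^ 'p \<Rightarrow> real ^ 'p ^ 'z" where
  "simplex_gradient_delta g y M =
     (\<chi> i. simplex_gradient g (y + column i M) M - simplex_gradient g y M)"

definition simplex_hessian :: "(real ^ 'p \<Rightarrow> real) \<Rightarrow> real ^ 'p \<Rightarrow> real ^ 'z ^ 'p \<Rightarrow> real ^ 'p ^ 'p" where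
  "simplex_hessian g y M = pinv (transpose M) ** simplex_gradient_delta g y M"

definition diam_bar :: "real ^ 'z ^ 'p \<Rightarrow> real" where
  "diam_bar M = Max (range (\<lambda>i. norm (column i M)))"

end

theory Submission
  imports Defs
begin

text \<open>Put \<open>X = R\<^sup>-\<^sup>T\<close> and let \<open>G\<close>, \<open>H\<close> be the gradient and Hessian of \<open>fhat\<close>. The simplex Hessian is
  \<open>B = X E X\<^sup>T\<close> for the symmetric matrix \<open>E\<close> of second differences along the columns of \<open>R\<close>,
  and \<open>E\<close> approximates \<open>R\<^sup>T H(0) R\<close> entrywise to order \<open>d\<^sup>3\<close>, where \<open>d\<close> is the largest column norm.
  In the linear coefficient \<open>b\<close> of the model the extrapolation between \<open>R\<close> and \<open>2R\<close> cancels the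
  quadratic Taylor terms, so \<open>b\<close> approximates \<open>G(0)\<close> to order \<open>d\<^sup>2\<close>.
  With \<open>t = sqrt p * \<kappa>\<close> the mean value theorem gives the errors \<open>2 L t\<^sup>2 d\<close> and \<open>6 L t d\<^sup>2\<close>;
  since \<open>t \<ge> 1\<close>, they and the Taylor remainders at \<open>0\<close>, estimated by the mean value theorem as well, fit
  into the claimed constants.\<close>

section \<open>Euclidean and spectral norm estimates\<close>

lemma inner_transpose_mult:
  fixes A :: "real ^ 'n ^ 'm"
  shows "x \<bullet> (transpose A *v y) = (A *v x) \<bullet> y"
  by (metis dot_lmul_matrix inner_commute transpose_matrix_vector)

lemma norm_le_sqrt_card:
  fixes x :: "real ^ 'n"
  assumes "\<And>i. \<bar>x $ i\<bar> \<le> c"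
  shows "norm x \<le> sqrt (real CARD('n)) * c"
proof -
  \<comment> \<open>Index types are nonempty, so an arbitrary index already forces the sign of
    \<open>c\<close>.\<close>
  have c: "0 \<le> c"
    using assms[of undefined] by linarith
  have "(\<Sum>i\<in>UNIV. (x $ i)\<^sup>2) \<le> (\<Sum>i\<in>(UNIV::'n set). c\<^sup>2)"
    by (intro sum_mono) (simp add: abs_le_square_iff[symmetric] c assms)
  then have "norm x \<le> sqrt (real CARD('n) * c\<^sup>2)"
    by (simp add: norm_vec_def L2_set_def)
  then show ?thesis
    using c by (simp add: real_sqrt_mult)
qed

lemma spectral_norm_pos: "0 \<le> spectral_norm A"
  unfolding spectral_norm_def by (rule onorm_pos_le) simp

lemma norm_mult_le_spectral_norm: "norm (A *v x) \<le> spectral_norm A * norm x"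
  unfolding spectral_norm_def by (rule onorm) simp

lemma spectral_norm_le:
  assumes "\<And>x. norm (A *v x) \<le> b * norm x"
  shows "spectral_norm A \<le> b"
  unfolding spectral_norm_def using assms by (rule onorm_le)

text \<open>With \<open>y = transpose A *v x\<close>, the square of \<open>norm y\<close> is the
  inner product of \<open>A *v y\<close> and \<open>x\<close>. Cauchy-Schwarz bounds it by
  \<open>spectral_norm A * norm y * norm x\<close>, and one factor \<open>norm y\<close>
  cancels.\<close>

lemma spectral_norm_transpose_le: "spectral_norm (transpose A) \<le> spectral_norm A"
proof (rule spectral_norm_le)
  fix x
  let ?y = "transpose A *v x"
  have "norm ?y * norm ?y = ?y \<bullet> ?y"
    by (simp only: dot_square_norm power2_eq_square)
  also have "\<dots> = (A *v ?y) \<bullet> x"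
    by (rule inner_transpose_mult)
  also have "\<dots> \<le> norm (A *v ?y) * norm x"
    by (rule norm_cauchy_schwarz)
  also have "\<dots> \<le> (spectral_norm A * norm ?y) * norm x"
    by (intro mult_right_mono norm_mult_le_spectral_norm) simp
  finally have "norm ?y * norm ?y \<le> norm ?y * (spectral_norm A * norm x)"
    by (simp only: ac_simps)
  \<comment> \<open>This settles the case \<open>norm ?y = 0\<close>, where the factor cannot be
    cancelled.\<close>
  moreover have "0 \<le> spectral_norm A * norm x"
    by (simp add: spectral_norm_pos)
  ultimately show "norm ?y \<le> spectral_norm A * norm x"
    using mult_left_le_imp_le[of "norm ?y" "norm ?y" "spectral_norm A * norm x"] norm_ge_zero[of ?y]
    by argo
qed

lemma spectral_norm_mult_le: "spectral_norm (A ** B) \<le> spectral_norm A * spectral_norm B"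
proof (rule spectral_norm_le)
  fix x
  have "norm (A *v (B *v x)) \<le> spectral_norm A * norm (B *v x)"
    by (rule norm_mult_le_spectral_norm)
  also have "\<dots> \<le> spectral_norm A * (spectral_norm B * norm x)"
    by (intro mult_left_mono norm_mult_le_spectral_norm spectral_norm_pos)
  finally show "norm ((A ** B) *v x) \<le> spectral_norm A * spectral_norm B * norm x"
    by (simp add: matrix_vector_mul_assoc mult.assoc)
qed

lemma spectral_norm_add_le: "spectral_norm (A + B) \<le> spectral_norm A + spectral_norm B"
proof (rule spectral_norm_le)
  fix x
  have "norm (A *v x + B *v x) \<le> norm (A *v x) + norm (B *v x)"
    by (rule norm_triangle_ineq)
  then show "norm ((A + B) *v x) \<le> (spectral_norm A + spectral_norm B) * norm x"
    using norm_mult_le_spectral_norm[of A x] norm_mult_le_spectral_norm[of B x]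
    by (simp add: algebra_simps)
qed

text \<open>Cauchy-Schwarz in each row bounds every coordinate of the product. This serves both the
  entrywise matrix bound and the lower bound \<open>1 \<le> t\<close>.\<close>

lemma norm_mult_le_rows:
  fixes A :: "real ^ 'n ^ 'm"
  assumes "\<And>i. norm (A $ i) \<le> c"
  shows "norm (A *v x) \<le> sqrt (real CARD('m)) * (c * norm x)"
proof (rule norm_le_sqrt_card)
  fix i
  have "\<bar>A $ i \<bullet> x\<bar> \<le> norm (A $ i) * norm x"
    by (rule Cauchy_Schwarz_ineq2)
  also have "\<dots> \<le> c * norm x"
    by (intro mult_right_mono assms) simp
  finally show "\<bar>(A *v x) $ i\<bar> \<le> c * norm x"
    by (simp add: matrix_vector_mul_component)
qed

text \<open>One square root of the dimension comes from the norm of a row, the other from the number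
  of rows.\<close>

lemma spectral_norm_le_entries:
  fixes A :: "real ^ 'n ^ 'n"
  assumes "\<And>i j. \<bar>A $ i $ j\<bar> \<le> c"
  shows "spectral_norm A \<le> real CARD('n) * c"
proof (rule spectral_norm_le)
  fix x
  have "norm (A *v x) \<le> sqrt (real CARD('n)) * ((sqrt (real CARD('n)) * c) * norm x)"
    by (intro norm_mult_le_rows norm_le_sqrt_card assms)
  then show "norm (A *v x) \<le> real CARD('n) * c * norm x"
    by (simp flip: mult.assoc)
qed

lemma norm_mult_orthonormal:
  fixes Q :: "real ^ 'p ^ 'n"
  assumes "orthonormal_columns Q"
  shows "norm (Q *v x) = norm x"
proof -
  have "transpose Q ** Q = mat 1"
    using assms
    by (simp add: matrix_mult_transpose_dot_column orthonormal_columns_def mat_def)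
  then have "(Q *v x) \<bullet> (Q *v x) = x \<bullet> x"
    by (metis inner_transpose_mult matrix_vector_mul_assoc matrix_vector_mul_lid)
  then show ?thesis
    by (simp add: norm_eq_sqrt_inner)
qed

text \<open>\<open>Q\<close> is an isometry, so its spectral norm is at most 1, and transposition
  does not increase the spectral norm.\<close>

lemma norm_transpose_orthonormal_le:
  assumes "orthonormal_columns Q"
  shows "norm (transpose Q *v x) \<le> norm x"
proof -
  have "spectral_norm Q \<le> 1"
    by (rule spectral_norm_le) (simp add: norm_mult_orthonormal[OF assms])
  then have "spectral_norm (transpose Q) \<le> 1"
    using spectral_norm_transpose_le order_trans by blast
  then show ?thesis
    using norm_mult_le_spectral_norm[of "transpose Q" x]
    by (meson mult_left_le_one_le norm_ge_zero order_trans spectral_norm_pos)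
qed

section \<open>Inverses and pseudoinverses\<close>

lemma pinv_inverse:
  assumes "A ** X = mat 1" "X ** A = mat 1"
  shows "pinv A = X"
  using assms by (intro pinv_eqI) (simp add: is_pinv_def)

lemma matrix_inv_eqI:
  fixes A :: "real ^ 'n ^ 'n"
  assumes "A ** X = mat 1" "X ** A = mat 1"
  shows "matrix_inv A = X"
proof -
  have "A ** matrix_inv A = mat 1 \<and> matrix_inv A ** A = mat 1"
    unfolding matrix_inv_def by (rule someI[of _ X]) (simp add: assms)
  then show ?thesis
    by (metis assms(2) matrix_mul_assoc matrix_mul_lid matrix_mul_rid)
qed

section \<open>Gradients and Hessians, in particular of quadratic models\<close>

lemma has_derivative_grad:
  assumes "f differentiable (at x)"
  shows "(f has_derivative (\<lambda>h. grad f x \<bullet> h)) (at x)"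
proof -
  let ?F = "frechet_derivative f (at x)"
  have lin: "linear ?F"
    using assms linear_frechet_derivative by blast
  have "?F h = grad f x \<bullet> h" for h
  proof -
    have "?F h = ?F (\<Sum>i\<in>UNIV. (h $ i) *\<^sub>R axis i 1)"
      using basis_expansion[of h] by (simp add: scalar_mult_eq_scaleR)
    also have "\<dots> = grad f x \<bullet> h"
      by (simp add: linear_sum[OF lin] linear_scale[OF lin] inner_vec_def grad_def mult.commute)
    finally show ?thesis .
  qed
  then have "?F = (\<lambda>h. grad f x \<bullet> h)"
    by blast
  then show ?thesis
    using assms by (simp add: frechet_derivative_works)
qed

lemma grad_eqI:
  assumes "(f has_derivative (\<lambda>h. v \<bullet> h)) (at x)"
  shows "grad f x = v"
  by (simp add: vec_eq_iff grad_def frechet_derivative_at[OF assms, symmetric] inner_axis)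

lemma hessian_eqI:
  assumes "(grad f has_derivative (\<lambda>h. A *v h)) (at x)"
  shows "hessian f x = A"
  by (simp add: hessian_def jacobian_def frechet_derivative_at[OF assms, symmetric])

text \<open>Differentiating the quadratic form yields two cross terms; symmetry of \<open>B\<close>
  makes them equal, which absorbs the factor 1/2.\<close>

lemma grad_quadratic:
  assumes "transpose B = B"
  shows "grad (\<lambda>s. c + b \<bullet> s + 1 / 2 * (s \<bullet> (B *v s))) s = b + B *v s"
proof (rule grad_eqI)
  have sym: "h \<bullet> (B *v s) = s \<bullet> (B *v h)" for h
    by (metis assms inner_commute inner_transpose_mult)
  have B: "((*v) B has_derivative (*v) B) (at s)"
    by (rule bounded_linear_imp_has_derivative) simp
  have "((\<lambda>s. c + b \<bullet> s + 1 / 2 * (s \<bullet> (B *v s))) has_derivative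
      (\<lambda>h. b \<bullet> h + 1 / 2 * (s \<bullet> (B *v h) + h \<bullet> (B *v s)))) (at s)"
    by (rule derivative_eq_intros B refl | simp)+
  then show "((\<lambda>s. c + b \<bullet> s + 1 / 2 * (s \<bullet> (B *v s))) has_derivative
      (\<lambda>h. (b + B *v s) \<bullet> h)) (at s)"
    by (simp add: sym inner_add_left inner_commute[of "B *v s"])
qed

lemma hessian_quadratic:
  assumes "transpose B = B"
  shows "hessian (\<lambda>s. c + b \<bullet> s + 1 / 2 * (s \<bullet> (B *v s))) s = B"
proof (rule hessian_eqI)
  show "(grad (\<lambda>s. c + b \<bullet> s + 1 / 2 * (s \<bullet> (B *v s))) has_derivative (*v) B) (at s)"
    unfolding grad_quadratic[OF assms, abs_def]
    using has_derivative_add[OF has_derivative_const bounded_linear_imp_has_derivative[OF matrix_vector_mul_bounded_linear], of b B]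
    by simp
qed

section \<open>Scaling, columns and congruences of matrices\<close>

lemma spectral_norm_scaleR: "spectral_norm (c *\<^sub>R A) = \<bar>c\<bar> * spectral_norm A"
  using onorm_scaleR[of "(*v) A" c]
  by (simp add: spectral_norm_def scaleR_matrix_vector_assoc[symmetric])

lemma transpose_nth: "transpose A $ i = column i A"
  by (simp add: transpose_def column_def)

lemma column_scaleR: "column i (c *\<^sub>R A) = c *\<^sub>R column i A"
  by (simp add: column_def vec_eq_iff)

lemma matrix_diff_ldistrib:
  fixes A :: "real ^ 'm ^ 'n"
  shows "A ** (B - C) = A ** B - A ** C"
  by (simp add: matrix_matrix_mult_def vec_eq_iff right_diff_distrib sum_subtractf)

lemma matrix_diff_rdistrib:
  fixes A :: "real ^ 'm ^ 'n"
  shows "(A - B) ** C = A ** C - B ** C"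
  by (simp add: matrix_matrix_mult_def vec_eq_iff left_diff_distrib sum_subtractf)

text \<open>Brings the congruence into the form of second derivatives along the columns of
  \<open>R\<close>, which second differences approximate.\<close>

lemma congruence_entry:
  fixes A :: "real ^ 'p ^ 'p"
  shows "(transpose R ** A ** R) $ i $ j = column i R \<bullet> (A *v column j R)"
proof -
  have "(transpose R ** A ** R) $ i $ j = axis i 1 \<bullet> ((transpose R ** A ** R) *v axis j 1)"
    by (simp add: inner_axis' matrix_vector_mul_component inner_axis)
  also have "\<dots> = (R *v axis i 1) \<bullet> (A *v (R *v axis j 1))"
    by (simp only: inner_transpose_mult flip: matrix_vector_mul_assoc)
  finally show ?thesis
    by (simp add: matrix_vector_mult_basis)
qed

section \<open>Column norms and simplex derivatives for an invertible matrix\<close>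

lemma norm_column_le_diam_bar: "norm (column i M) \<le> diam_bar M"
  unfolding diam_bar_def by (rule Max_ge) auto

text \<open>A zero column of \<open>M\<close> would be a zero row of its transpose, contradicting a
  diagonal entry of \<open>mat 1\<close>. Positivity justifies dividing by
  \<open>diam_bar\<close>.\<close>

lemma diam_bar_pos:
  assumes "transpose M ** X = mat 1"
  shows "0 < diam_bar M"
proof -
  have "column i M \<noteq> 0" for i
  proof
    assume "column i M = 0"
    then have "(transpose M ** X) $ i $ i = 0"
      by (simp add: matrix_matrix_mult_def transpose_def column_def vec_eq_iff)
    then show False
      by (simp add: assms mat_def)
  qed
  then show ?thesis
    by (metis norm_column_le_diam_bar less_le_trans zero_less_norm_iff)
qed

lemma simplex_gradient_inverse:
  assumes "transpose M ** X = mat 1" "X ** transpose M = mat 1"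
  shows "simplex_gradient g y M = X *v simplex_delta g y M"
  by (simp add: simplex_gradient_def pinv_inverse[OF assms])

text \<open>The matrix \<open>E\<close> of the overview, written so that its symmetry in
  \<open>i\<close> and \<open>j\<close> is visible.\<close>

definition second_differences :: "(real ^ 'p \<Rightarrow> real) \<Rightarrow> real ^ 'p \<Rightarrow> real ^ 'z ^ 'p \<Rightarrow> real ^ 'z ^ 'z" where
  "second_differences g y M = (\<chi> i j.
     g (y + column i M + column j M) - g (y + column i M) - g (y + column j M) + g y)"

text \<open>Each row of \<open>simplex_gradient_delta\<close> is \<open>X\<close> applied to a
  difference of two \<open>simplex_delta\<close> vectors, that is, to a row of second differences.
  Stacking the rows puts \<open>transpose X\<close> on the right.\<close>

lemma simplex_hessian_inverse:
  assumes "transpose M ** X = mat 1" "X ** transpose M = mat 1"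
  shows "simplex_hessian g y M = X ** second_differences g y M ** transpose X"
proof -
  have "simplex_gradient_delta g y M = second_differences g y M ** transpose X"
    unfolding simplex_gradient_delta_def simplex_gradient_inverse[OF assms]
      matrix_vector_mult_diff_distrib[symmetric]
    by (simp add: vec_eq_iff matrix_matrix_mult_def matrix_vector_mult_def transpose_def
        simplex_delta_def second_differences_def algebra_simps)
  then show ?thesis
    by (simp add: simplex_hessian_def pinv_inverse[OF assms] matrix_mul_assoc)
qed

text \<open>A congruence preserves the symmetry of the second differences. The derivative formulas
  for the quadratic model depend on this.\<close>

lemma transpose_simplex_hessian:
  assumes "transpose M ** X = mat 1" "X ** transpose M = mat 1"
  shows "transpose (simplex_hessian g y M) = simplex_hessian g y M"
proof -
  have "transpose (second_differences g y M) = second_differences g y M"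
    by (simp add: second_differences_def transpose_def vec_eq_iff algebra_simps)
  then show ?thesis
    by (simp add: simplex_hessian_inverse[OF assms] matrix_transpose_mul matrix_mul_assoc)
qed

section \<open>Taylor estimates under a Lipschitz Hessian\<close>

text \<open>The derivatives \<open>G\<close> and \<open>H\<close> are parameters, so the chain rule
  expressions for \<open>fhat\<close> can be inserted directly in place of \<open>grad\<close> and
  \<open>hessian\<close>.\<close>

definition lipschitz_hessian :: "(real ^ 'p \<Rightarrow> real) \<Rightarrow> (real ^ 'p \<Rightarrow> real ^ 'p) \<Rightarrow>
    (real ^ 'p \<Rightarrow> real ^ 'p ^ 'p) \<Rightarrow> real \<Rightarrow> bool" where
  "lipschitz_hessian g G H L \<longleftrightarrow>
     (\<forall>x. (g has_derivative (\<lambda>h. G x \<bullet> h)) (at x)) \<and>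
     (\<forall>x. (G has_derivative (*v) (H x)) (at x)) \<and>
     0 \<le> L \<and>
     (\<forall>x y. spectral_norm (H x - H y) \<le> L * norm (x - y))"

lemma
  assumes "lipschitz_hessian g G H L"
  shows has_derivative_gradient: "(g has_derivative (\<lambda>h. G x \<bullet> h)) (at x)"
    and has_derivative_hessian: "(G has_derivative (*v) (H x)) (at x)"
    and lipschitz_const_nonneg: "0 \<le> L"
    and hessian_lipschitz: "spectral_norm (H x - H y) \<le> L * norm (x - y)"
  using assms by (auto simp: lipschitz_hessian_def)

text \<open>Mean value inequality for \<open>G\<close> minus its linearization by
  \<open>H z\<close>: on the ball the Hessian differs from \<open>H z\<close> by at most
  \<open>L * c\<close>. The centre \<open>z\<close> may differ from both endpoints, as second
  differences require.\<close>

lemma gradient_increment: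
  assumes lip: "lipschitz_hessian g G H L"
    and ab: "a \<in> cball z c" "b \<in> cball z c"
  shows "norm (G b - G a - H z *v (b - a)) \<le> norm (b - a) * (L * c)"
proof (rule differentiable_bound_linearization[where S = "cball z c" and f' = "\<lambda>x h. H x *v h"])
  show "a + t *\<^sub>R (b - a) \<in> cball z c" if "t \<in> {0..1}" for t
    using convexD_alt[OF convex_cball ab, of t] that by (simp add: algebra_simps)
  show "onorm ((*v) (H x) - (*v) (H z)) \<le> L * c" if "x \<in> cball z c" for x
  proof -
    have "spectral_norm (H x - H z) \<le> L * c"
      using hessian_lipschitz[OF lip, of x z] that
        mult_left_mono[OF _ lipschitz_const_nonneg[OF lip], of "norm (x - z)" c]
      by (simp add: dist_norm norm_minus_commute)
    then show ?thesis
      by (simp add: spectral_norm_def fun_diff_def matrix_vector_mult_diff_rdistrib)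
  qed
  \<comment> \<open>The radius is nonnegative because the ball contains \<open>a\<close>.\<close>
  show "z \<in> cball z c"
    using ab(1) by (simp add: order_trans[OF zero_le_dist])
qed (auto intro: has_derivative_at_withinI has_derivative_hessian[OF lip])

lemma gradient_taylor:
  assumes lip: "lipschitz_hessian g G H L"
  shows "norm (G (z + s) - G z - H z *v s) \<le> L * (norm s)\<^sup>2"
  using gradient_increment[OF lip, of z z "norm s" "z + s"]
  by (simp add: dist_norm power2_eq_square mult_ac)

lemma has_real_derivative_along:
  assumes lip: "lipschitz_hessian g G H L"
  shows "((\<lambda>t. g (x + t *\<^sub>R v)) has_real_derivative G (x + t *\<^sub>R v) \<bullet> v) (at t)"
proof -
  have "((\<lambda>t. g (x + t *\<^sub>R v)) has_derivative (\<lambda>h. G (x + t *\<^sub>R v) \<bullet> (h *\<^sub>R v))) (at t)"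
    by (rule has_derivative_compose[OF _ has_derivative_gradient[OF lip]]) (auto intro!: derivative_eq_intros)
  then show ?thesis
    by (simp add: has_field_derivative_def mult.commute[of _ "G (x + t *\<^sub>R v) \<bullet> v"])
qed

text \<open>The one-variable mean value theorem along the segment reduces the claim to
  \<open>gradient_taylor\<close>. It yields the constant \<open>L\<close>, coarser than the
  \<open>L / 6\<close> of the integral remainder but sufficient here.\<close>

lemma taylor:
  assumes lip: "lipschitz_hessian g G H L"
  shows "\<bar>g (z + s) - g z - G z \<bullet> s - 1 / 2 * (s \<bullet> (H z *v s))\<bar> \<le> L * norm s ^ 3"
proof -
  \<comment> \<open>The increment of \<open>?\<phi>\<close> from 0 to 1 is exactly the Taylor
    remainder.\<close>
  let ?\<phi> = "\<lambda>t. g (z + t *\<^sub>R s) - t * (G z \<bullet> s) - 1 / 2 * t\<^sup>2 * (s \<bullet> (H z *v s))"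
  let ?\<phi>' = "\<lambda>t. G (z + t *\<^sub>R s) \<bullet> s - G z \<bullet> s - t * (s \<bullet> (H z *v s))"
  have "(?\<phi> has_real_derivative ?\<phi>' t) (at t)" for t
    by (auto intro!: derivative_eq_intros has_real_derivative_along[OF lip])
  then obtain t where t: "0 < t" "t < 1" "?\<phi> 1 - ?\<phi> 0 = (1 - 0) * ?\<phi>' t"
    using MVT2[of 0 1 ?\<phi> ?\<phi>'] by auto
  have "?\<phi>' t = (G (z + t *\<^sub>R s) - G z - H z *v (t *\<^sub>R s)) \<bullet> s"
    by (simp add: inner_diff_left matrix_vector_mult_scaleR inner_diff_right inner_commute[of _ s])
  also have "\<bar>\<dots>\<bar> \<le> (L * (norm (t *\<^sub>R s))\<^sup>2) * norm s"
    by (rule order_trans[OF Cauchy_Schwarz_ineq2]) (intro mult_right_mono gradient_taylor[OF lip] norm_ge_zero)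
  also have "\<dots> \<le> (L * (norm s)\<^sup>2) * norm s"
    using t(1,2)
    by (intro mult_right_mono mult_left_mono power_mono lipschitz_const_nonneg[OF lip] norm_ge_zero)
      (simp add: mult_left_le_one_le)
  also have "\<dots> = L * norm s ^ 3"
    by (simp add: eval_nat_numeral)
  finally show ?thesis
    using t(3) by simp
qed

text \<open>The mean value theorem in the direction \<open>v\<close> turns the second difference
  into an increment of \<open>G\<close> along \<open>u\<close>, which
  \<open>gradient_increment\<close> compares with \<open>H z *v u\<close>.\<close>

lemma second_difference:
  assumes lip: "lipschitz_hessian g G H L"
  shows "\<bar>(g (z + u + v) - g (z + v)) - (g (z + u) - g z) - (H z *v u) \<bullet> v\<bar>
     \<le> L * (norm u + norm v) * norm u * norm v"
proof -
  let ?\<psi> = "\<lambda>t. g (z + u + t *\<^sub>R v) - g (z + t *\<^sub>R v)"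
  let ?\<psi>' = "\<lambda>t. G (z + u + t *\<^sub>R v) \<bullet> v - G (z + t *\<^sub>R v) \<bullet> v"
  have "(?\<psi> has_real_derivative ?\<psi>' t) (at t)" for t
    by (intro DERIV_diff has_real_derivative_along[OF lip])
  then obtain t where t: "0 < t" "t < 1" "?\<psi> 1 - ?\<psi> 0 = (1 - 0) * ?\<psi>' t"
    using MVT2[of 0 1 ?\<psi> ?\<psi>'] by auto
  have dist: "dist z (z + x) = norm x" for x
    by (simp add: dist_norm)
  have tv: "norm (t *\<^sub>R v) \<le> norm v"
    using t by (auto intro: mult_left_le_one_le)
  \<comment> \<open>Together with \<open>tv\<close>, this puts both ends of the shifted segment into
    the ball of radius \<open>norm u + norm v\<close> about \<open>z\<close>.\<close>
  have "norm (u + t *\<^sub>R v) \<le> norm u + norm v"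
    using norm_triangle_ineq[of u "t *\<^sub>R v"] tv by linarith
  then have "norm (G (z + u + t *\<^sub>R v) - G (z + t *\<^sub>R v) - H z *v (z + u + t *\<^sub>R v - (z + t *\<^sub>R v)))
      \<le> norm (z + u + t *\<^sub>R v - (z + t *\<^sub>R v)) * (L * (norm u + norm v))"
    using order_trans[OF tv, of "norm u + norm v"]
    by (intro gradient_increment[OF lip]) (simp_all add: dist add.assoc)
  then have le: "norm (G (z + u + t *\<^sub>R v) - G (z + t *\<^sub>R v) - H z *v u)
      \<le> L * (norm u + norm v) * norm u"
    by (simp add: mult_ac)
  have "?\<psi>' t - (H z *v u) \<bullet> v = (G (z + u + t *\<^sub>R v) - G (z + t *\<^sub>R v) - H z *v u) \<bullet> v"
    by (simp add: inner_diff_left)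
  also have "\<bar>\<dots>\<bar> \<le> L * (norm u + norm v) * norm u * norm v"
    by (rule order_trans[OF Cauchy_Schwarz_ineq2]) (intro mult_right_mono le norm_ge_zero)
  finally show ?thesis
    using t(3) by simp
qed

section \<open>Accuracy of the simplex Hessian and of the extrapolated simplex gradient\<close>

text \<open>Since \<open>X\<close> inverts \<open>transpose R\<close>, the true Hessian is also a
  congruence by \<open>X\<close>, namely of \<open>transpose R ** H z ** R\<close>. Hence the error
  is the congruence by \<open>X\<close> of an entrywise small matrix \<open>W\<close>.\<close>

lemma simplex_hessian_error:
  fixes R X :: "real ^ 'p ^ 'p"
  assumes lip: "lipschitz_hessian g G H L"
    and inv: "transpose R ** X = mat 1" "X ** transpose R = mat 1"
    and d: "\<And>i. norm (column i R) \<le> d"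
  shows "spectral_norm (H z - simplex_hessian g z R)
    \<le> (spectral_norm X)\<^sup>2 * (real CARD('p) * (2 * L * d ^ 3))"
proof -
  define W where "W = transpose R ** H z ** R - second_differences g z R"
  have RX: "R ** transpose X = mat 1"
    using arg_cong[OF inv(2), of transpose] by (simp add: matrix_transpose_mul)
  have "X ** (transpose R ** H z ** R) ** transpose X = (X ** transpose R) ** H z ** (R ** transpose X)"
    by (simp only: matrix_mul_assoc)
  then have "H z = X ** (transpose R ** H z ** R) ** transpose X"
    by (simp only: inv RX matrix_mul_lid matrix_mul_rid)
  then have W: "H z - simplex_hessian g z R = X ** W ** transpose X"
    by (simp add: simplex_hessian_inverse[OF inv] W_def matrix_diff_ldistrib matrix_diff_rdistrib)
  have "\<bar>W $ i $ j\<bar> \<le> 2 * L * d ^ 3" for i j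
  proof -
    \<comment> \<open>The order matches \<open>congruence_entry\<close>, where the Hessian acts on
      column \<open>j\<close>.\<close>
    let ?u = "column j R" and ?v = "column i R"
    have "\<bar>W $ i $ j\<bar> =
        \<bar>(g (z + ?u + ?v) - g (z + ?v)) - (g (z + ?u) - g z) - (H z *v ?u) \<bullet> ?v\<bar>"
      by (simp add: W_def congruence_entry second_differences_def inner_commute abs_minus_commute
          algebra_simps)
    also have "\<dots> \<le> L * (norm ?u + norm ?v) * norm ?u * norm ?v"
      by (rule second_difference[OF lip])
    also have "\<dots> \<le> L * (d + d) * d * d"
      using lipschitz_const_nonneg[OF lip] order_trans[OF norm_ge_zero d]
      by (intro mult_mono add_mono d mult_nonneg_nonneg add_nonneg_nonneg) auto
    finally show ?thesis
      by (simp add: power3_eq_cube)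
  qed
  then have "spectral_norm W \<le> real CARD('p) * (2 * L * d ^ 3)"
    by (rule spectral_norm_le_entries)
  then have "spectral_norm X * spectral_norm W * spectral_norm (transpose X)
      \<le> spectral_norm X * (real CARD('p) * (2 * L * d ^ 3)) * spectral_norm X"
    using order_trans[OF norm_ge_zero d] lipschitz_const_nonneg[OF lip]
    by (intro mult_mono spectral_norm_transpose_le) (auto intro!: mult_nonneg_nonneg spectral_norm_pos)
  moreover have "spectral_norm (X ** W ** transpose X)
      \<le> spectral_norm X * spectral_norm W * spectral_norm (transpose X)"
    by (meson mult_right_mono order_trans spectral_norm_mult_le spectral_norm_pos)
  ultimately show ?thesis
    by (simp add: W power2_eq_square mult_ac)
qed

text \<open>The error is \<open>X *v w\<close>, where each entry of \<open>w\<close> contains only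
  cubic Taylor remainders.\<close>

lemma simplex_gradient_error:
  fixes R X :: "real ^ 'p ^ 'p"
  assumes lip: "lipschitz_hessian g G H L"
    and inv: "transpose R ** X = mat 1" "X ** transpose R = mat 1"
    and d: "\<And>i. norm (column i R) \<le> d"
  shows "norm (G z - (2 *\<^sub>R simplex_gradient g z R - simplex_gradient g z (2 *\<^sub>R R)))
    \<le> spectral_norm X * (sqrt (real CARD('p)) * (6 * L * d ^ 3))"
proof -
  define w where "w = transpose R *v G z
    - (2 *\<^sub>R simplex_delta g z R - (1 / 2) *\<^sub>R simplex_delta g z (2 *\<^sub>R R))"
  \<comment> \<open>Doubling \<open>R\<close> halves the inverse of its transpose, hence the weight
    1/2 in \<open>w\<close>.\<close>
  have inv2: "transpose (2 *\<^sub>R R) ** ((1 / 2) *\<^sub>R X) = mat 1"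
      "((1 / 2) *\<^sub>R X) ** transpose (2 *\<^sub>R R) = mat 1"
    by (simp_all add: transpose_scalar matrix_scalar_ac inv flip: scalar_matrix_assoc)
  have "G z = X *v (transpose R *v G z)"
    by (simp only: matrix_vector_mul_assoc inv matrix_vector_mul_lid)
  then have w: "G z - (2 *\<^sub>R simplex_gradient g z R - simplex_gradient g z (2 *\<^sub>R R)) = X *v w"
    unfolding simplex_gradient_inverse[OF inv] simplex_gradient_inverse[OF inv2] w_def
    by (simp only: matrix_vector_mult_diff_distrib matrix_vector_mult_scaleR scaleR_matrix_vector_assoc)
  have "\<bar>w $ i\<bar> \<le> 6 * L * d ^ 3" for i
  proof -
    let ?r = "column i R"
    define T where "T s = g (z + s) - g z - G z \<bullet> s - 1 / 2 * (s \<bullet> (H z *v s))" for s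
    have T: "\<bar>T s\<bar> \<le> L * norm s ^ 3" for s
      unfolding T_def by (rule taylor[OF lip])
    \<comment> \<open>The first-order terms have total weight \<open>1 - 2 + 2/2 = 0\<close> and the
      second-order terms \<open>-2 + 4/2 = 0\<close>.\<close>
    have "w $ i = 1 / 2 * T (2 *\<^sub>R ?r) - 2 * T ?r"
      by (simp add: T_def w_def simplex_delta_def matrix_vector_mul_component column_scaleR
          matrix_vector_mult_scaleR transpose_nth inner_commute[of "G z"] field_simps
          del: transpose_matrix_vector)
    then have "\<bar>w $ i\<bar> \<le> 1 / 2 * \<bar>T (2 *\<^sub>R ?r)\<bar> + 2 * \<bar>T ?r\<bar>"
      using abs_triangle_ineq4[of "1 / 2 * T (2 *\<^sub>R ?r)" "2 * T ?r"] by (simp add: abs_mult)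
    \<comment> \<open>Doubling the step multiplies the cubic bound by 8, and
      \<open>8/2 + 2 = 6\<close>.\<close>
    also have "\<dots> \<le> 1 / 2 * (L * (2 * d) ^ 3) + 2 * (L * d ^ 3)"
      using d[of i] lipschitz_const_nonneg[OF lip]
      by (intro add_mono mult_left_mono order_trans[OF T] power_mono) auto
    also have "\<dots> = 6 * L * d ^ 3"
      by (simp add: power_mult_distrib)
    finally show ?thesis .
  qed
  then have "norm w \<le> sqrt (real CARD('p)) * (6 * L * d ^ 3)"
    by (rule norm_le_sqrt_card)
  then show ?thesis
    unfolding w by (meson mult_left_mono norm_mult_le_spectral_norm order_trans spectral_norm_pos)
qed

section \<open>Restriction to the affine subspace spanned by \<open>Q\<close>\<close>

lemma spectral_norm_congruence_le:
  assumes "orthonormal_columns Q"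
  shows "spectral_norm (transpose Q ** A ** Q) \<le> spectral_norm A"
proof (rule spectral_norm_le)
  fix x
  have "norm (transpose Q *v (A *v (Q *v x))) \<le> norm (A *v (Q *v x))"
    by (rule norm_transpose_orthonormal_le[OF assms])
  also have "\<dots> \<le> spectral_norm A * norm x"
    using norm_mult_le_spectral_norm[of A "Q *v x"] by (simp only: norm_mult_orthonormal[OF assms])
  finally show "norm ((transpose Q ** A ** Q) *v x) \<le> spectral_norm A * norm x"
    by (simp only: matrix_vector_mul_assoc matrix_mul_assoc)
qed

text \<open>The chain rule gives the derivatives. The constant \<open>L\<close> survives because
  \<open>Q\<close> preserves distances between arguments and the compression by \<open>Q\<close>
  does not increase spectral norms.\<close>

lemma lipschitz_hessian_restrict:
  assumes f: "C2_plus f L" and Q: "orthonormal_columns Q"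
  shows "lipschitz_hessian (\<lambda>s. f (x0 + Q *v s)) (\<lambda>s. transpose Q *v grad f (x0 + Q *v s))
    (\<lambda>s. transpose Q ** hessian f (x0 + Q *v s) ** Q) L"
  unfolding lipschitz_hessian_def
proof (intro conjI allI)
  have df: "\<And>x. f differentiable (at x)" "\<And>x. grad f differentiable (at x)"
    and L: "0 \<le> L" and lip: "\<And>x y. spectral_norm (hessian f x - hessian f y) \<le> L * norm (x - y)"
    using f by (auto simp: C2_plus_def)
  have aff: "((\<lambda>s. x0 + Q *v s) has_derivative (*v) Q) (at x)" for x
    using has_derivative_add[OF has_derivative_const
        bounded_linear_imp_has_derivative[OF matrix_vector_mul_bounded_linear], of x0 Q]
    by simp
  have dgrad: "(grad f has_derivative (*v) (hessian f x)) (at x)" for x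
    using df(2) by (simp add: hessian_def jacobian_works)
  show "0 \<le> L"
    by (rule L)
  fix x y
  have "((\<lambda>s. f (x0 + Q *v s)) has_derivative (\<lambda>h. grad f (x0 + Q *v x) \<bullet> (Q *v h))) (at x)"
    by (rule has_derivative_compose[OF aff has_derivative_grad[OF df(1)]])
  moreover have "grad f (x0 + Q *v x) \<bullet> (Q *v h) = (transpose Q *v grad f (x0 + Q *v x)) \<bullet> h" for h
    by (metis inner_commute inner_transpose_mult)
  ultimately show "((\<lambda>s. f (x0 + Q *v s)) has_derivative
      (\<lambda>h. (transpose Q *v grad f (x0 + Q *v x)) \<bullet> h)) (at x)"
    by simp
  have "((\<lambda>s. transpose Q *v grad f (x0 + Q *v s)) has_derivative
      (\<lambda>h. transpose Q *v (hessian f (x0 + Q *v x) *v (Q *v h)))) (at x)"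
    by (rule bounded_linear.has_derivative[OF matrix_vector_mul_bounded_linear
        has_derivative_compose[OF aff dgrad]])
  then show "((\<lambda>s. transpose Q *v grad f (x0 + Q *v s)) has_derivative
      (*v) (transpose Q ** hessian f (x0 + Q *v x) ** Q)) (at x)"
    by (simp only: matrix_vector_mul_assoc matrix_mul_assoc)
  have "transpose Q ** hessian f (x0 + Q *v x) ** Q - transpose Q ** hessian f (x0 + Q *v y) ** Q
      = transpose Q ** (hessian f (x0 + Q *v x) - hessian f (x0 + Q *v y)) ** Q"
    by (simp add: matrix_diff_ldistrib matrix_diff_rdistrib)
  moreover have "norm ((x0 + Q *v x) - (x0 + Q *v y)) = norm (x - y)"
    using norm_mult_orthonormal[OF Q, of "x - y"] by (simp add: matrix_vector_mult_diff_distrib)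
  moreover have "spectral_norm (transpose Q ** (hessian f (x0 + Q *v x) - hessian f (x0 + Q *v y)) ** Q)
      \<le> L * norm ((x0 + Q *v x) - (x0 + Q *v y))"
    by (rule order_trans[OF spectral_norm_congruence_le[OF Q] lip])
  ultimately show "spectral_norm (transpose Q ** hessian f (x0 + Q *v x) ** Q
      - transpose Q ** hessian f (x0 + Q *v y) ** Q) \<le> L * norm (x - y)"
    by (simp only:)
qed

section \<open>Scaling by \<open>diam_bar\<close> and the error of the model\<close>

text \<open>\<open>K\<close> is the inverse transpose of the scaled matrix, so dividing it by
  \<open>diam_bar R\<close> inverts \<open>transpose R\<close>. For the last claim, the scaled
  columns have norm at most 1, so the transposed scaled matrix stretches a unit vector by at most
  \<open>sqrt p\<close>; \<open>K\<close> must undo this.\<close>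

lemma scaled_inverse_transpose_bound:
  fixes R :: "real ^ 'p ^ 'p"
  assumes "invertible R"
  defines "K \<equiv> transpose (matrix_inv ((1 / diam_bar R) *\<^sub>R R))"
  shows "0 < diam_bar R"
    and "transpose R ** ((1 / diam_bar R) *\<^sub>R K) = mat 1"
    and "((1 / diam_bar R) *\<^sub>R K) ** transpose R = mat 1"
    and "1 \<le> sqrt (real CARD('p)) * spectral_norm K"
proof -
  obtain Y where Y: "R ** Y = mat 1" "Y ** R = mat 1"
    using assms(1) by (auto simp: invertible_def)
  have X: "transpose R ** transpose Y = mat 1" "transpose Y ** transpose R = mat 1"
    using Y by (metis matrix_transpose_mul transpose_mat)+
  show d: "0 < diam_bar R"
    by (rule diam_bar_pos[OF X(1)])
  have "matrix_inv ((1 / diam_bar R) *\<^sub>R R) = diam_bar R *\<^sub>R Y"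
    using d by (intro matrix_inv_eqI) (simp_all add: matrix_scalar_ac Y flip: scalar_matrix_assoc)
  then have K: "K = diam_bar R *\<^sub>R transpose Y"
    by (simp add: K_def transpose_scalar)
  then show inv: "transpose R ** ((1 / diam_bar R) *\<^sub>R K) = mat 1"
    and "((1 / diam_bar R) *\<^sub>R K) ** transpose R = mat 1"
    using d X by simp_all
  let ?A = "transpose ((1 / diam_bar R) *\<^sub>R R)"
  have AK: "K ** ?A = mat 1"
    using d X by (simp add: K transpose_scalar matrix_scalar_ac flip: scalar_matrix_assoc)
  obtain x :: "real ^ 'p" where x: "norm x = 1"
    using norm_axis_1 by blast
  have "norm (?A $ i) \<le> 1" for i
    using d norm_column_le_diam_bar[of i R]
    by (simp add: transpose_nth column_scaleR)
  then have "norm (?A *v x) \<le> sqrt (real CARD('p)) * (1 * norm x)"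
    by (rule norm_mult_le_rows)
  then have "spectral_norm K * norm (?A *v x) \<le> spectral_norm K * sqrt (real CARD('p))"
    by (intro mult_left_mono spectral_norm_pos) (simp add: x)
  moreover have "norm (K *v (?A *v x)) = 1"
    by (simp only: matrix_vector_mul_assoc AK matrix_vector_mul_lid x)
  ultimately have "1 \<le> spectral_norm K * sqrt (real CARD('p))"
    using norm_mult_le_spectral_norm[of K "?A *v x"] by (simp only:)
  then show "1 \<le> sqrt (real CARD('p)) * spectral_norm K"
    by (simp only: mult.commute)
qed

text \<open>Each factor \<open>spectral_norm X\<close> contributes \<open>\<kappa> / d\<close>. This
  lowers the power of \<open>d\<close> and combines \<open>\<kappa>\<close> with the dimension
  factors into powers of \<open>t\<close>.\<close>

lemma model_coefficients_error:
  fixes R :: "real ^ 'p ^ 'p"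
  assumes lip: "lipschitz_hessian g G H L" and R: "invertible R"
  defines "t \<equiv> sqrt (real CARD('p)) * spectral_norm (transpose (matrix_inv ((1 / diam_bar R) *\<^sub>R R)))"
  shows "0 < diam_bar R" and "1 \<le> t"
    and "transpose (simplex_hessian g 0 R) = simplex_hessian g 0 R"
    and "spectral_norm (H 0 - simplex_hessian g 0 R) \<le> L * (2 * t\<^sup>2) * diam_bar R"
    and "norm (G 0 - (2 *\<^sub>R simplex_gradient g 0 R - simplex_gradient g 0 (2 *\<^sub>R R)))
      \<le> L * (6 * t) * (diam_bar R)\<^sup>2"
proof -
  define d where "d = diam_bar R"
  define p where "p = real CARD('p)"
  define K where "K = transpose (matrix_inv ((1 / d) *\<^sub>R R))"
  define X where "X = (1 / d) *\<^sub>R K"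
  have t_def: "t = sqrt p * spectral_norm K"
    by (simp add: t_def p_def K_def d_def)
  have d: "0 < d" and inv: "transpose R ** X = mat 1" "X ** transpose R = mat 1" and t: "1 \<le> t"
    using scaled_inverse_transpose_bound[OF R] by (simp_all add: d_def X_def K_def t_def p_def)
  then show "0 < diam_bar R" and "1 \<le> t"
    by (simp_all only: d_def)
  show "transpose (simplex_hessian g 0 R) = simplex_hessian g 0 R"
    by (rule transpose_simplex_hessian[OF inv])
  have X: "spectral_norm X = spectral_norm K / d"
    using d by (simp add: X_def spectral_norm_scaleR)
  have r: "norm (column i R) \<le> d" for i
    by (simp add: d_def norm_column_le_diam_bar)
  have "(spectral_norm K / d)\<^sup>2 * (p * (2 * L * d ^ 3)) = L * (2 * t\<^sup>2) * d"
    using d by (simp add: t_def p_def power_mult_distrib) (simp add: eval_nat_numeral)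
  then show "spectral_norm (H 0 - simplex_hessian g 0 R) \<le> L * (2 * t\<^sup>2) * diam_bar R"
    using simplex_hessian_error[OF lip inv r, of 0] by (simp only: X p_def d_def)
  have "spectral_norm K / d * (sqrt p * (6 * L * d ^ 3)) = L * (6 * t) * d\<^sup>2"
    using d by (simp add: t_def eval_nat_numeral)
  then show "norm (G 0 - (2 *\<^sub>R simplex_gradient g 0 R - simplex_gradient g 0 (2 *\<^sub>R R)))
      \<le> L * (6 * t) * (diam_bar R)\<^sup>2"
    using simplex_gradient_error[OF lip inv r, of 0] by (simp only: X p_def d_def)
qed

lemma model_error_bounds:
  fixes R :: "real ^ 'p ^ 'p"
  assumes lip: "lipschitz_hessian g G H L" and R: "invertible R"
    and m: "m = (\<lambda>s. g 0
      + (2 *\<^sub>R simplex_gradient g 0 R - simplex_gradient g 0 (2 *\<^sub>R R)) \<bullet> s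
      + 1 / 2 * (s \<bullet> (simplex_hessian g 0 R *v s)))"
    and s: "norm s \<le> diam_bar R"
  defines "d \<equiv> diam_bar R" and "p \<equiv> real CARD('p)"
    and "\<kappa> \<equiv> spectral_norm (transpose (matrix_inv ((1 / diam_bar R) *\<^sub>R R)))"
  shows "spectral_norm (H s - hessian m s) \<le> L * (4 * p * \<kappa>\<^sup>2 + 1) * d"
    and "norm (G s - grad m s) \<le> 3 * sqrt p * L * \<kappa> * (2 * p * \<kappa>\<^sup>2 + 1) * d\<^sup>2"
    and "\<bar>g s - m s\<bar>
      \<le> (sqrt p * L * \<kappa> * (6 * p * \<kappa>\<^sup>2 + 2 * sqrt p * \<kappa> + 3) + 2 / 3 * L) * d ^ 3"
proof -
  define b where "b = 2 *\<^sub>R simplex_gradient g 0 R - simplex_gradient g 0 (2 *\<^sub>R R)"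
  define B where "B = simplex_hessian g 0 R"
  \<comment> \<open>All three claimed constants are \<open>L\<close> times a polynomial in
    \<open>t\<close>, so each bound reduces to a polynomial inequality for \<open>t\<close> at least
    1.\<close>
  define t where "t = sqrt p * \<kappa>"
  have d: "0 < d" and t: "1 \<le> t" and sym: "transpose B = B"
    and HB: "spectral_norm (H 0 - B) \<le> L * (2 * t\<^sup>2) * d"
    and Gb: "norm (G 0 - b) \<le> L * (6 * t) * d\<^sup>2"
    using model_coefficients_error[OF lip R]
    by (simp_all only: d_def t_def p_def \<kappa>_def B_def b_def)
  have t2: "t\<^sup>2 = p * \<kappa>\<^sup>2"
    by (simp add: t_def power_mult_distrib p_def)
  have L: "0 \<le> L"
    by (rule lipschitz_const_nonneg[OF lip])
  have m': "m = (\<lambda>s. g 0 + b \<bullet> s + 1 / 2 * (s \<bullet> (B *v s)))"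
    by (simp only: m b_def B_def)
  have grad_m: "grad m s = b + B *v s" and hess_m: "hessian m s = B"
    unfolding m' by (rule grad_quadratic[OF sym] hessian_quadratic[OF sym])+
  have s: "norm s \<le> d"
    using s by (simp only: d_def)
  have s2: "L * (norm s)\<^sup>2 \<le> L * d\<^sup>2" and s3: "L * norm s ^ 3 \<le> L * d ^ 3"
    using s L by (auto intro!: mult_left_mono power_mono)
  have HBs: "norm ((H 0 - B) *v s) \<le> L * (2 * t\<^sup>2) * d\<^sup>2"
  proof -
    have "norm ((H 0 - B) *v s) \<le> (L * (2 * t\<^sup>2) * d) * d"
      using s d L t by (intro order_trans[OF norm_mult_le_spectral_norm] mult_mono HB) auto
    then show ?thesis
      by (simp add: power2_eq_square mult.assoc)
  qed
  have "spectral_norm (H s - B) \<le> spectral_norm (H s - H 0) + spectral_norm (H 0 - B)"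
    using spectral_norm_add_le[of "H s - H 0" "H 0 - B"] by simp
  also have "\<dots> \<le> L * d + L * (2 * t\<^sup>2) * d"
    using hessian_lipschitz[OF lip, of s 0] mult_left_mono[OF s L] HB by simp
  also have "\<dots> \<le> L * (4 * t\<^sup>2 + 1) * d"
    using L d by (simp add: algebra_simps mult_left_mono)
  finally show "spectral_norm (H s - hessian m s) \<le> L * (4 * p * \<kappa>\<^sup>2 + 1) * d"
    by (simp add: hess_m t2 mult.assoc)

  \<comment> \<open>Taylor remainder at 0, error of the linear coefficient, error of the
    Hessian.\<close>
  have "G s - grad m s = (G (0 + s) - G 0 - H 0 *v s) + (G 0 - b) + (H 0 - B) *v s"
    by (simp add: grad_m matrix_vector_mult_diff_rdistrib)
  also have "norm \<dots> \<le> L * d\<^sup>2 + L * (6 * t) * d\<^sup>2 + L * (2 * t\<^sup>2) * d\<^sup>2"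
    by (intro norm_triangle_le add_mono order_trans[OF gradient_taylor[OF lip] s2] Gb HBs)
  also have "\<dots> = L * d\<^sup>2 * (1 + 6 * t + 2 * t\<^sup>2)"
    by (simp add: algebra_simps)
  also have "\<dots> \<le> L * d\<^sup>2 * (3 * t * (2 * t\<^sup>2 + 1))"
  proof (rule mult_left_mono)
    \<comment> \<open>equality at \<open>t = 1\<close>, hence the factor \<open>t - 1\<close>\<close>
    have "0 \<le> (t - 1) * (6 * t\<^sup>2 + 4 * t + 1)"
      using t by simp
    then show "1 + 6 * t + 2 * t\<^sup>2 \<le> 3 * t * (2 * t\<^sup>2 + 1)"
      by (simp add: algebra_simps power2_eq_square power3_eq_cube)
  qed (simp add: L)
  finally show "norm (G s - grad m s) \<le> 3 * sqrt p * L * \<kappa> * (2 * p * \<kappa>\<^sup>2 + 1) * d\<^sup>2"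
    unfolding t2 unfolding t_def by (simp only: mult_ac)

  \<comment> \<open>The same three error sources, integrated once; the constant terms agree.\<close>
  have "g s - m s = (g (0 + s) - g 0 - G 0 \<bullet> s - 1 / 2 * (s \<bullet> (H 0 *v s)))
      + (G 0 - b) \<bullet> s + 1 / 2 * (s \<bullet> ((H 0 - B) *v s))"
    by (simp add: m' matrix_vector_mult_diff_rdistrib inner_diff_left inner_diff_right field_simps)
  also have "\<bar>\<dots>\<bar> \<le> L * d ^ 3 + L * (6 * t) * d\<^sup>2 * d + 1 / 2 * (d * (L * (2 * t\<^sup>2) * d\<^sup>2))"
  proof -
    have "\<bar>(G 0 - b) \<bullet> s\<bar> \<le> L * (6 * t) * d\<^sup>2 * d"
      using s d L t
      by (intro order_trans[OF Cauchy_Schwarz_ineq2] mult_mono Gb) auto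
    moreover have "\<bar>s \<bullet> ((H 0 - B) *v s)\<bar> \<le> d * (L * (2 * t\<^sup>2) * d\<^sup>2)"
      using s d by (intro order_trans[OF Cauchy_Schwarz_ineq2] mult_mono HBs) auto
    then have "\<bar>1 / 2 * (s \<bullet> ((H 0 - B) *v s))\<bar> \<le> 1 / 2 * (d * (L * (2 * t\<^sup>2) * d\<^sup>2))"
      by (simp only: abs_mult)
    ultimately show ?thesis
      by (intro order_trans[OF abs_triangle_ineq] add_mono order_trans[OF taylor[OF lip] s3])
  qed
  also have "\<dots> = L * d ^ 3 * (1 + 6 * t + t\<^sup>2)"
    by (simp add: algebra_simps power2_eq_square power3_eq_cube)
  also have "\<dots> \<le> L * d ^ 3 * (t * (6 * t\<^sup>2 + 2 * t + 3) + 2 / 3)"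
  proof (rule mult_left_mono)
    \<comment> \<open>The difference of the two sides below is this product plus 11/3.\<close>
    have "0 \<le> (t - 1) * (6 * t\<^sup>2 + 7 * t + 4)"
      using t by simp
    then show "1 + 6 * t + t\<^sup>2 \<le> t * (6 * t\<^sup>2 + 2 * t + 3) + 2 / 3"
      by (simp add: algebra_simps power2_eq_square power3_eq_cube)
  qed (use L d in simp)
  finally show "\<bar>g s - m s\<bar>
      \<le> (sqrt p * L * \<kappa> * (6 * p * \<kappa>\<^sup>2 + 2 * sqrt p * \<kappa> + 3) + 2 / 3 * L) * d ^ 3"
    unfolding t2 unfolding t_def by (simp add: algebra_simps)
qed

text \<open>Since \<open>fhat\<close> is \<open>f\<close> restricted to an affine subspace, the
  projected derivatives of \<open>f\<close> are the derivatives of \<open>fhat\<close>. The claim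
  thus becomes a statement about \<open>fhat\<close> and the square matrix \<open>R\<close>.\<close>

theorem theorem5:
  fixes f :: "real ^ 'n \<Rightarrow> real"
    and L :: real
    and D Q :: "real ^ ('p::{finite,linorder}) ^ 'n"
    and R Rhat :: "real ^ ('p::{finite,linorder}) ^ ('p::{finite,linorder})"
    and x0 :: "real ^ 'n"
    and fhat mhat :: "real ^ ('p::{finite,linorder}) \<Rightarrow> real"
    and p :: real
    and \<kappa> :: real
  assumes f: "C2_plus f L"
    and D: "rank D = CARD('p::{finite,linorder})"
    and QR: "is_QR_factorization D Q R"
    and fhat: "\<And>s. fhat s = f (x0 + Q *v s)"
    and mhat: "\<And>s. mhat s = fhat 0
        + (2 *\<^sub>R simplex_gradient fhat 0 R - simplex_gradient fhat 0 (2 *\<^sub>R R)) \<bullet> s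
        + 1 / 2 * (s \<bullet> (simplex_hessian fhat 0 R *v s))"
    and Rhat: "Rhat = (1 / diam_bar R) *\<^sub>R R"
    and p: "p = real CARD('p::{finite,linorder})"
    and \<kappa>: "\<kappa> = spectral_norm (transpose (matrix_inv Rhat))"
  shows "\<forall>s. norm s \<le> diam_bar R \<longrightarrow>
      spectral_norm (transpose Q ** hessian f (x0 + Q *v s) ** Q - hessian mhat s)
        \<le> L * (4 * p * \<kappa>\<^sup>2 + 1) * diam_bar R
    \<and> norm (transpose Q *v grad f (x0 + Q *v s) - grad mhat s)
        \<le> 3 * sqrt p * L * \<kappa> * (2 * p * \<kappa>\<^sup>2 + 1) * (diam_bar R)\<^sup>2
    \<and> \<bar>f (x0 + Q *v s) - mhat s\<bar>
        \<le> (sqrt p * L * \<kappa> * (6 * p * \<kappa>\<^sup>2 + 2 * sqrt p * \<kappa> + 3) + 2 / 3 * L) * diam_bar R ^ 3"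
proof (intro allI impI)
  fix s :: "real ^ ('p::{finite,linorder})"
  assume s: "norm s \<le> diam_bar R"
  have Q: "orthonormal_columns Q" and R: "invertible R"
    using QR by (auto simp: is_QR_factorization_def)
  have "fhat = (\<lambda>s. f (x0 + Q *v s))"
    using fhat by blast
  then have lip: "lipschitz_hessian fhat (\<lambda>s. transpose Q *v grad f (x0 + Q *v s))
      (\<lambda>s. transpose Q ** hessian f (x0 + Q *v s) ** Q) L"
    using lipschitz_hessian_restrict[OF f Q] by (simp only:)
  have m: "mhat = (\<lambda>s. fhat 0
      + (2 *\<^sub>R simplex_gradient fhat 0 R - simplex_gradient fhat 0 (2 *\<^sub>R R)) \<bullet> s
      + 1 / 2 * (s \<bullet> (simplex_hessian fhat 0 R *v s)))"
    using mhat by blast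
  show "spectral_norm (transpose Q ** hessian f (x0 + Q *v s) ** Q - hessian mhat s)
        \<le> L * (4 * p * \<kappa>\<^sup>2 + 1) * diam_bar R
    \<and> norm (transpose Q *v grad f (x0 + Q *v s) - grad mhat s)
        \<le> 3 * sqrt p * L * \<kappa> * (2 * p * \<kappa>\<^sup>2 + 1) * (diam_bar R)\<^sup>2
    \<and> \<bar>f (x0 + Q *v s) - mhat s\<bar>
        \<le> (sqrt p * L * \<kappa> * (6 * p * \<kappa>\<^sup>2 + 2 * sqrt p * \<kappa> + 3) + 2 / 3 * L) * diam_bar R ^ 3"
    using model_error_bounds[OF lip R m s] by (simp only: fhat Rhat p \<kappa>)
qed

end
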